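(* Let $X$ be a metrizable topological space and let $\mathcal{F}$ be a weakly equicontinuous semi-decomposition on $X$. Then $\mathcal{F}$ is $R$-closed and of characteristic $0$.
   Context: A semi-decomposition on a set $X$ is a map $\mathcal{F}\colon X\to 2^X$ such that (1) $x\in\mathcal{F}(x)$ for all $x\in X$, and (2) $\mathcal{F}(x)\subseteq\mathcal{F}(y)$ for all $x,y\in X$ with $x\in\mathcal{F}(y)$. The element closure of $x$ is $\overline{\mathcal{F}(x)}$. For non-empty subsets $A,B$ of a metric space $(X,d)$, the Hausdorff distance is $d_H(A,B):=\inf\{\varepsilon>0\mid A\subseteq U_\varepsilon(B),\ B\subseteq U_\varepsilon(A)\}\in\mathbb{R}_{\ge 0}\sqcup\{\infty\}$, where $U_\varepsilon(C):=\bigcup_{x\in C}\{y\in X\mid d(y,x)<\varepsilon\}$ (with $\inf\emptyset=\infty$). A semi-decomposition $\mathcal{F}$ on a metric space $(X,d)$ is weakly equicontinuous if for every $\varepsilon>0$ there is $\delta>0$ such that $d_H(\mathcal{F}(x),\mathcal{F}(y))<\varepsilon$ for all $x,y\in X$ with $d(x,y)<\delta$. A semi-decomposition on a metrizable space $X$ is weakly equicontinuous if it is weakly equicontinuous on $(X,d)$ for some metric $d$ compatible with the topology of $X$. $\mathcal{F}$ is $R$-closed if the element closure relation $R=\{(x,y)\in X\times X\mid y\in\overline{\mathcal{F}(x)}\}$ is a closed subset of $X\times X$ with the product topology. The (bilateral) prolongation of $x\in X$ is $D(x)=\{y\in X\mid \text{there are nets }(x_\alpha),(y_\alpha)\text{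 in }X\text{ (with the same index set) such that } y_\alpha\in\mathcal{F}(x_\alpha),\ y_\alpha\to y,\ x_\alpha\to x\}$. $\mathcal{F}$ is of characteristic $0$ if $\overline{\mathcal{F}(x)}=D(x)$ for every $x\in X$. *)

theory Defs
  imports "HOL-Analysis.Analysis"
begin

definition semi_decomposition_on :: "'a set \<Rightarrow> ('a \<Rightarrow> 'a set) \<Rightarrow> bool" where
  "semi_decomposition_on X F \<longleftrightarrow>
     F \<in> X \<rightarrow> Pow X \<and>
     (\<forall>x\<in>X. x \<in> F x) \<and>
     (\<forall>x\<in>X. \<forall>y\<in>X. x \<in> F y \<longrightarrow> F x \<subseteq> F y)"

context Metric_space
begin

(* The infimum is taken in ereal, where the infimum of the empty set is \<infinity>. *)
definition hausdorff_distance :: "'a set \<Rightarrow> 'a set \<Rightarrow> ereal" where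
  "hausdorff_distance A B =
     Inf {ereal \<epsilon> | \<epsilon>. \<epsilon> > 0 \<and> A \<subseteq> (\<Union>x\<in>B. mball x \<epsilon>) \<and> B \<subseteq> (\<Union>x\<in>A. mball x \<epsilon>)}"

definition metric_weakly_equicontinuous :: "('a \<Rightarrow> 'a set) \<Rightarrow> bool" where
  "metric_weakly_equicontinuous F \<longleftrightarrow>
     (\<forall>\<epsilon>::real. \<epsilon> > 0 \<longrightarrow>
        (\<exists>\<delta>>0. \<forall>x\<in>M. \<forall>y\<in>M. d x y < \<delta> \<longrightarrow> hausdorff_distance (F x) (F y) < ereal \<epsilon>))"

end

definition weakly_equicontinuous :: "'a topology \<Rightarrow> ('a \<Rightarrow> 'a set) \<Rightarrow> bool" where
  "weakly_equicontinuous X F \<longleftrightarrow>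
     (\<exists>d. Metric_space (topspace X) d \<and> Metric_space.mtopology (topspace X) d = X \<and>
          Metric_space.metric_weakly_equicontinuous (topspace X) d F)"

definition element_closure_relation :: "'a topology \<Rightarrow> ('a \<Rightarrow> 'a set) \<Rightarrow> ('a \<times> 'a) set" where
  "element_closure_relation X F =
     {(x, y) \<in> topspace X \<times> topspace X. y \<in> X closure_of F x}"

definition R_closed :: "'a topology \<Rightarrow> ('a \<Rightarrow> 'a set) \<Rightarrow> bool" where
  "R_closed X F \<longleftrightarrow> closedin (prod_topology X X) (element_closure_relation X F)"

(* (i, j) \<in> r is read as i \<le> j. *)
definition directed_set :: "'i set \<Rightarrow> ('i \<times> 'i) set \<Rightarrow> bool" where
  "directed_set I r \<longleftrightarrow>
     I \<noteq> {} \<and> preorder_on I r \<and> (\<forall>i\<in>I. \<forall>j\<in>I. \<exists>k\<in>I. (i, k) \<in> r \<and> (j, k) \<in> r)"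

definition tail_filter :: "'i set \<Rightarrow> ('i \<times> 'i) set \<Rightarrow> 'i filter" where
  "tail_filter I r = (INF i\<in>I. principal {j \<in> I. (i, j) \<in> r})"

lemma eventually_tail_filter:
  assumes "directed_set I r"
  shows "eventually P (tail_filter I r) \<longleftrightarrow> (\<exists>i\<in>I. \<forall>j\<in>I. (i, j) \<in> r \<longrightarrow> P j)"
proof -
  have "I \<noteq> {}" and tr: "trans r"
    and dir: "\<And>i j. i \<in> I \<Longrightarrow> j \<in> I \<Longrightarrow> \<exists>k\<in>I. (i, k) \<in> r \<and> (j, k) \<in> r"
    using assms by (auto simp: directed_set_def preorder_on_def)
  have "\<exists>k\<in>I. principal {l \<in> I. (k, l) \<in> r} \<le>
      inf (principal {l \<in> I. (i, l) \<in> r}) (principal {l \<in> I. (j, l) \<in> r})"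
    if ij: "i \<in> I" "j \<in> I" for i j
  proof -
    obtain k where "k \<in> I" "(i, k) \<in> r" "(j, k) \<in> r" using dir[OF ij] by blast
    then show ?thesis by (auto intro!: bexI[of _ k] dest: transD[OF tr])
  qed
  then show ?thesis
    unfolding tail_filter_def
    by (subst eventually_INF_base) (auto simp: eventually_principal \<open>I \<noteq> {}\<close>)
qed

definition net_pair_witness ::
  "'a topology \<Rightarrow> ('a \<Rightarrow> 'a set) \<Rightarrow> 'a \<Rightarrow> 'a \<Rightarrow>
   'i set \<Rightarrow> ('i \<times> 'i) set \<Rightarrow> ('i \<Rightarrow> 'a) \<Rightarrow> ('i \<Rightarrow> 'a) \<Rightarrow> bool" where
  "net_pair_witness X F x y I r xs ys \<longleftrightarrow>
     directed_set I r \<and>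
     xs \<in> I \<rightarrow> topspace X \<and> ys \<in> I \<rightarrow> topspace X \<and> (\<forall>i\<in>I. ys i \<in> F (xs i)) \<and>
     limitin X ys y (tail_filter I r) \<and> limitin X xs x (tail_filter I r)"

(* HOL cannot quantify over the type of the index set inside a definition. Nets indexed by
   subsets of the type of pairs of sets suffice: see prolongation_if_net_pair_witness. *)
definition prolongation :: "'a topology \<Rightarrow> ('a \<Rightarrow> 'a set) \<Rightarrow> 'a \<Rightarrow> 'a set" where
  "prolongation X F x =
     {y \<in> topspace X. \<exists>(I :: ('a set \<times> 'a set) set) r xs ys. net_pair_witness X F x y I r xs ys}"

lemma prolongation_if_net_pair_witness:
  fixes I :: "'i set"
  assumes "net_pair_witness X F x y I r xs ys"
  shows "y \<in> prolongation X F x"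
proof -
  have D: "directed_set I r"
    and in_F: "\<And>i. i \<in> I \<Longrightarrow> ys i \<in> F (xs i)"
    and in_X: "\<And>i. i \<in> I \<Longrightarrow> xs i \<in> topspace X" "\<And>i. i \<in> I \<Longrightarrow> ys i \<in> topspace X"
    and lim: "limitin X ys y (tail_filter I r)" "limitin X xs x (tail_filter I r)"
    using assms by (auto simp: net_pair_witness_def)
  have xy: "x \<in> topspace X" "y \<in> topspace X"
    using lim by (auto simp: limitin_def)
  define J where "J = {(U, V). openin X U \<and> x \<in> U \<and> openin X V \<and> y \<in> V}"
  define s where "s = {(p, q). p \<in> J \<and> q \<in> J \<and> fst q \<subseteq> fst p \<and> snd q \<subseteq> snd p}"
  have "\<exists>i\<in>I. xs i \<in> fst p \<and> ys i \<in> snd p" if "p \<in> J" for p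
  proof -
    have "eventually (\<lambda>i. xs i \<in> fst p) (tail_filter I r)"
      "eventually (\<lambda>i. ys i \<in> snd p) (tail_filter I r)"
      using lim that by (auto simp: limitin_def J_def)
    then have "eventually (\<lambda>i. xs i \<in> fst p \<and> ys i \<in> snd p) (tail_filter I r)"
      by (rule eventually_conj)
    then obtain i where "i \<in> I" "\<forall>j\<in>I. (i, j) \<in> r \<longrightarrow> xs j \<in> fst p \<and> ys j \<in> snd p"
      using eventually_tail_filter[OF D] by auto
    moreover have "(i, i) \<in> r"
      using D \<open>i \<in> I\<close> by (auto simp: directed_set_def preorder_on_def refl_on_def)
    ultimately show ?thesis by blast
  qed
  then obtain f where f: "\<And>p. p \<in> J \<Longrightarrow> f p \<in> I \<and> xs (f p) \<in> fst p \<and> ys (f p) \<in> snd p"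
    by metis
  have top: "(topspace X, topspace X) \<in> J"
    using xy by (auto simp: J_def)
  have "\<exists>k\<in>J. (p, k) \<in> s \<and> (q, k) \<in> s" if "p \<in> J" "q \<in> J" for p q
    using that
    by (intro bexI[of _ "(fst p \<inter> fst q, snd p \<inter> snd q)"]) (auto simp: s_def J_def)
  then have D': "directed_set J s"
    using top unfolding directed_set_def preorder_on_def
    by (auto simp: s_def refl_on_def intro!: transI)
  have "limitin X (xs \<circ> f) x (tail_filter J s)"
    unfolding limitin_def eventually_tail_filter[OF D']
  proof (intro conjI allI impI xy)
    fix U assume "openin X U \<and> x \<in> U"
    then show "\<exists>i\<in>J. \<forall>j\<in>J. (i, j) \<in> s \<longrightarrow> (xs \<circ> f) j \<in> U"
      using f xy by (intro bexI[of _ "(U, topspace X)"]) (auto simp: s_def J_def)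
  qed
  moreover have "limitin X (ys \<circ> f) y (tail_filter J s)"
    unfolding limitin_def eventually_tail_filter[OF D']
  proof (intro conjI allI impI xy)
    fix V assume "openin X V \<and> y \<in> V"
    then show "\<exists>i\<in>J. \<forall>j\<in>J. (i, j) \<in> s \<longrightarrow> (ys \<circ> f) j \<in> V"
      using f xy by (intro bexI[of _ "(topspace X, V)"]) (auto simp: s_def J_def)
  qed
  ultimately have "net_pair_witness X F x y J s (xs \<circ> f) (ys \<circ> f)"
    using D' f in_F in_X by (auto simp: net_pair_witness_def)
  then show ?thesis
    using xy unfolding prolongation_def by blast
qed

definition characteristic_0 :: "'a topology \<Rightarrow> ('a \<Rightarrow> 'a set) \<Rightarrow> bool" where
  "characteristic_0 X F \<longleftrightarrow> (\<forall>x \<in> topspace X. X closure_of F x = prolongation X F x)"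

end

(* Both the relation R and the prolongation lie in the closure of the graph of F (the prolongation
   of x is in fact the fibre over x of that closure). If (x, y) is in the closure of the graph, then
   some y' in F x' is close to y with x' close to x, and weak equicontinuity moves y' to a nearby
   point of F x; hence y is in the closure of F x. *)
theory Submission
  imports Defs
begin

text \<open>\<open>F\<close> is a total function on the type, so its arguments are restricted to the
  points of the space; its values outside are arbitrary.\<close>

definition graph_on :: "'a topology \<Rightarrow> ('a \<Rightarrow> 'a set) \<Rightarrow> ('a \<times> 'a) set" where
  "graph_on X F = Sigma (topspace X) F"

text \<open>Open boxes form a base of the product topology, so it suffices to test the closure on
  them. Since \<open>U\<close> lies in the space, \<open>b \<in> F a\<close> with
  \<open>a \<in> U\<close> already makes \<open>(a, b)\<close> a point of the graph.\<close>

lemma in_closure_of_graph_on_iff: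
  "(x, y) \<in> prod_topology X X closure_of graph_on X F \<longleftrightarrow>
     x \<in> topspace X \<and> y \<in> topspace X \<and>
     (\<forall>U V. openin X U \<and> x \<in> U \<and> openin X V \<and> y \<in> V \<longrightarrow>
       (\<exists>a\<in>U. \<exists>b\<in>V. b \<in> F a))" (is "?L \<longleftrightarrow> ?R")
proof
  assume L: ?L
  have "\<exists>a\<in>U. \<exists>b\<in>V. b \<in> F a"
    if "openin X U" "x \<in> U" "openin X V" "y \<in> V" for U V
  proof -
    have "openin (prod_topology X X) (U \<times> V)" "(x, y) \<in> U \<times> V"
      using that by (auto simp: openin_prod_Times_iff)
    with L obtain p where "p \<in> graph_on X F" "p \<in> U \<times> V"
      by (meson in_closure_of)
    then show ?thesis by (auto simp: graph_on_def)
  qed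
  with L show ?R by (auto simp: in_closure_of)
next
  assume R: ?R
  have "\<exists>p. p \<in> graph_on X F \<and> p \<in> T"
    if xyT: "(x, y) \<in> T" and T: "openin (prod_topology X X) T" for T
  proof -
    obtain U V where UV: "openin X U" "openin X V" "x \<in> U" "y \<in> V" "U \<times> V \<subseteq> T"
      using T[unfolded openin_prod_topology_alt, rule_format, OF xyT] by auto
    with R obtain a b where ab: "a \<in> U" "b \<in> V" "b \<in> F a" by meson
    then have "(a, b) \<in> graph_on X F"
      using openin_subset[OF UV(1)] by (auto simp: graph_on_def)
    with ab UV(5) show ?thesis by blast
  qed
  with R show ?L by (simp add: in_closure_of)
qed

text \<open>The first coordinate can stay fixed: every box around \<open>(x, y)\<close> contains a
  graph point lying over \<open>x\<close> itself.\<close>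

lemma element_closure_relation_subset_closure_of_graph_on:
  "element_closure_relation X F \<subseteq> prod_topology X X closure_of graph_on X F"
proof clarify
  fix x y assume "(x, y) \<in> element_closure_relation X F"
  then have "x \<in> topspace X" "y \<in> topspace X"
    and "\<And>V. openin X V \<Longrightarrow> y \<in> V \<Longrightarrow> \<exists>b. b \<in> F x \<and> b \<in> V"
    by (simp_all add: element_closure_relation_def in_closure_of)
  then show "(x, y) \<in> prod_topology X X closure_of graph_on X F"
    unfolding in_closure_of_graph_on_iff by blast
qed

lemma prolongation_subset_closure_of_graph_on:
  assumes "y \<in> prolongation X F x"
  shows "(x, y) \<in> prod_topology X X closure_of graph_on X F"
proof -
  obtain I :: "('a set \<times> 'a set) set" and r xs ys
    where W: "net_pair_witness X F x y I r xs ys"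
    using assms by (auto simp: prolongation_def)
  then have D: "directed_set I r" and in_F: "\<And>i. i \<in> I \<Longrightarrow> ys i \<in> F (xs i)"
    and lim: "limitin X ys y (tail_filter I r)" "limitin X xs x (tail_filter I r)"
    by (auto simp: net_pair_witness_def)
  have "\<exists>a\<in>U. \<exists>b\<in>V. b \<in> F a"
    if UV: "openin X U" "x \<in> U" "openin X V" "y \<in> V" for U V
  proof -
    have "eventually (\<lambda>i. xs i \<in> U) (tail_filter I r)" "eventually (\<lambda>i. ys i \<in> V) (tail_filter I r)"
      using lim UV by (auto simp: limitin_def)
    then have "eventually (\<lambda>i. xs i \<in> U \<and> ys i \<in> V) (tail_filter I r)"
      by (rule eventually_conj)
    then obtain i where i: "i \<in> I" "\<forall>j\<in>I. (i, j) \<in> r \<longrightarrow> xs j \<in> U \<and> ys j \<in> V"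
      using eventually_tail_filter[OF D] by auto
    \<comment> \<open>By reflexivity \<open>i\<close> belongs to its own tail, so
      \<open>(xs i, ys i)\<close> is a graph point in the box.\<close>
    moreover have "(i, i) \<in> r"
      using D i by (auto simp: directed_set_def preorder_on_def refl_on_def)
    ultimately show ?thesis using in_F by blast
  qed
  then show ?thesis
    using lim by (auto simp: in_closure_of_graph_on_iff limitin_def)
qed

text \<open>The constant net at \<open>x\<close> is paired with a net in \<open>F x\<close> that
  converges to \<open>y\<close>.\<close>

lemma closure_of_subset_prolongation:
  assumes x: "x \<in> topspace X" and F: "F x \<subseteq> topspace X"
  shows "X closure_of F x \<subseteq> prolongation X F x"
proof
  fix y assume y: "y \<in> X closure_of F x"
  then have yX: "y \<in> topspace X" by (auto simp: in_closure_of)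
  \<comment> \<open>The open neighbourhoods of \<open>y\<close>, directed by reverse inclusion,
    index the net; \<open>f\<close> picks a point of \<open>F x\<close> in each.\<close>
  define I where "I = {V. openin X V \<and> y \<in> V}"
  define r where "r = {(U, V). U \<in> I \<and> V \<in> I \<and> V \<subseteq> U}"
  have "\<forall>V\<in>I. \<exists>z. z \<in> F x \<and> z \<in> V"
    using y by (auto simp: I_def in_closure_of)
  then obtain f where f: "\<And>V. V \<in> I \<Longrightarrow> f V \<in> F x \<and> f V \<in> V"
    by metis
  have top: "topspace X \<in> I"
    using yX by (auto simp: I_def)
  have "\<exists>W\<in>I. (U, W) \<in> r \<and> (V, W) \<in> r" if "U \<in> I" "V \<in> I" for U V
    using that by (intro bexI[of _ "U \<inter> V"]) (auto simp: r_def I_def)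
  then have D: "directed_set I r"
    using top unfolding directed_set_def preorder_on_def
    by (auto simp: r_def refl_on_def intro!: transI)
  have "limitin X f y (tail_filter I r)"
    unfolding limitin_def eventually_tail_filter[OF D]
  proof (intro conjI allI impI yX)
    fix V assume "openin X V \<and> y \<in> V"
    then show "\<exists>i\<in>I. \<forall>j\<in>I. (i, j) \<in> r \<longrightarrow> f j \<in> V"
      using f by (intro bexI[of _ V]) (auto simp: r_def I_def)
  qed
  moreover have "limitin X (\<lambda>_. x) x (tail_filter I r)"
    using x by (auto simp: limitin_def)
  ultimately have "net_pair_witness X F x y I r (\<lambda>_. x) f"
    using D f F x by (auto simp: net_pair_witness_def)
  then show "y \<in> prolongation X F x"
    \<comment> \<open>The indices here are sets, not pairs of sets; this rule accepts nets over any
      index type.\<close>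
    by (rule prolongation_if_net_pair_witness)
qed

context Metric_space
begin

text \<open>An infimum below \<epsilon> yields an admissible radius \<eta> < \<epsilon>, and balls
  grow with their radius.\<close>

lemma hausdorff_distance_less_imp_near:
  assumes "hausdorff_distance A B < ereal \<epsilon>" and "a \<in> A"
  shows "\<exists>b\<in>B. a \<in> mball b \<epsilon>"
proof -
  obtain \<eta> where "\<eta> < \<epsilon>" "A \<subseteq> (\<Union>b\<in>B. mball b \<eta>)"
    using assms(1) unfolding hausdorff_distance_def Inf_less_iff by auto
  then show ?thesis
    using assms(2) mball_subset_concentric[of \<eta> \<epsilon>] by fastforce
qed

lemma metric_weakly_equicontinuous_closure_of_graph_on:
  assumes F: "metric_weakly_equicontinuous F"
    and xy: "(x, y) \<in> prod_topology mtopology mtopology closure_of graph_on mtopology F"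
  shows "y \<in> mtopology closure_of F x"
proof -
  have M: "x \<in> M" "y \<in> M"
    using xy by (auto simp: in_closure_of_graph_on_iff)
  have "\<exists>z\<in>F x. z \<in> mball y \<epsilon>" if "\<epsilon> > 0" for \<epsilon>
  proof -
    \<comment> \<open>One half of \<epsilon> pays for the step from \<open>y\<close> to
      \<open>b\<close>, the other for the step from \<open>b\<close> to a point of
      \<open>F x\<close>.\<close>
    obtain \<delta> where \<delta>: "\<delta> > 0"
      "\<And>u v. u \<in> M \<Longrightarrow> v \<in> M \<Longrightarrow> d u v < \<delta> \<Longrightarrow> hausdorff_distance (F u) (F v) < ereal (\<epsilon>/2)"
      using F \<open>\<epsilon> > 0\<close> unfolding metric_weakly_equicontinuous_def by (metis half_gt_zero)
    obtain a b where ab: "a \<in> mball x \<delta>" "b \<in> mball y (\<epsilon>/2)" "b \<in> F a"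
      using xy M \<delta>(1) \<open>\<epsilon> > 0\<close> unfolding in_closure_of_graph_on_iff
      by (metis centre_in_mball_iff half_gt_zero openin_mball)
    \<comment> \<open>The point \<open>a\<close> is within \<delta> of \<open>x\<close>, so
      \<open>b \<in> F a\<close> can be traded for a nearby \<open>z \<in> F x\<close>.\<close>
    then have "hausdorff_distance (F a) (F x) < ereal (\<epsilon>/2)"
      using \<delta>(2) by (simp add: commute)
    then obtain z where "z \<in> F x" "b \<in> mball z (\<epsilon>/2)"
      using ab(3) hausdorff_distance_less_imp_near by blast
    moreover have "d y z \<le> d y b + d b z"
      using ab calculation by (intro triangle) auto
    ultimately show ?thesis
      using ab(2) by (auto simp: commute intro!: bexI[of _ z])
  qed
  with M show ?thesis by (auto simp: metric_closure_of)
qed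

end

text \<open>The metric supplied by weak equicontinuity induces \<open>X\<close>, so the metric
  statement becomes a topological one.\<close>

lemma weakly_equicontinuous_closure_of_graph_on:
  assumes "weakly_equicontinuous X F"
    and "(x, y) \<in> prod_topology X X closure_of graph_on X F"
  shows "y \<in> X closure_of F x"
proof -
  obtain d where d: "Metric_space (topspace X) d"
    and top: "Metric_space.mtopology (topspace X) d = X"
    and F: "Metric_space.metric_weakly_equicontinuous (topspace X) d F"
    using assms(1) by (auto simp: weakly_equicontinuous_def)
  show ?thesis
    using Metric_space.metric_weakly_equicontinuous_closure_of_graph_on[OF d F, of x y] assms(2)
    by (simp add: top)
qed

theorem theorem1:
  fixes X :: "'a topology" and F :: "'a \<Rightarrow> 'a set"
  assumes "metrizable_space X"
    and "semi_decomposition_on (topspace X) F"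
    and "weakly_equicontinuous X F"
  shows "R_closed X F \<and> characteristic_0 X F"
proof
  let ?G = "prod_topology X X closure_of graph_on X F"
  have "?G \<subseteq> element_closure_relation X F"
    using weakly_equicontinuous_closure_of_graph_on[OF assms(3)]
    by (auto simp: element_closure_relation_def in_closure_of_graph_on_iff)
  \<comment> \<open>The relation coincides with a closure, which is why it is closed.\<close>
  then have "element_closure_relation X F = ?G"
    using element_closure_relation_subset_closure_of_graph_on by blast
  then show "R_closed X F"
    by (simp add: R_closed_def)
  have "X closure_of F x = prolongation X F x" if "x \<in> topspace X" for x
  proof
    show "X closure_of F x \<subseteq> prolongation X F x"
      using assms(2) that by (intro closure_of_subset_prolongation) (auto simp: semi_decomposition_on_def)
    \<comment> \<open>The inclusion passes through the closure of the graph.\<close>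
    show "prolongation X F x \<subseteq> X closure_of F x"
      using prolongation_subset_closure_of_graph_on
        weakly_equicontinuous_closure_of_graph_on[OF assms(3)] by fast
  qed
  then show "characteristic_0 X F"
    by (simp add: characteristic_0_def)
qed

end
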